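(* For all integers $n,m,k\ge 0$, $$\mathcal{R}_{n}^{k}(m)=\frac{1}{k!}\sum_{j=0}^{k}(-1)^{k-j}\binom{k}{j}\,\overline{P}(O_{n}+K_{m},j),$$ where $O_n$ is the empty (edgeless) graph on $n$ vertices, $K_m$ is the complete graph on $m$ vertices, and $O_n+K_m$ is their disjoint union.
   Context: Convention: $0^0=1$. The Pochhammer symbol is $(\nu)_m=\nu(\nu+1)\cdots(\nu+m-1)$, $(\nu)_0=1$. The $m$-Stirling numbers of the second kind are, for integers $n,k,m\ge0$, $$\mathcal{R}_n^k(m)=\frac{1}{k!}\sum_{j=0}^{k}(-1)^{k-j}\binom{k}{j}j^n (j)_m.$$ For a finite simple graph $G$ with vertex set $V$ and a non-negative integer $x$, $\overline{P}(G,x)$ is the number of pairs $(\sigma,\mathcal{O})$, where $\sigma:V\to\{1,2,\dots,x\}$ is any map and $\mathcal{O}$ is an orientation of $G$, such that $\sigma$ is compatible with $\mathcal{O}$, meaning: (1) $\mathcal{O}$ is acyclic; (2) if $u\to v$ in $\mathcal{O}$, then $\sigma(u)\ge\sigma(v)$. By a theorem of Stanley, $\overline{P}(G,x)=(-1)^{|V|}P(G,-x)$, where $P(G,\cdot)$ is the chromatic polynomial of $G$. *)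

theory Defs
  imports Complex_Main "HOL-Library.FuncSet" "Graph_Theory.Graph_Theory"
begin

text \<open>The convention \<open>0 ^ 0 = 1\<close> is built into \<open>(^)\<close>, and \<open>pochhammer x m\<close> is the rising factorial
  \<open>(x)\<^sub>m\<close>.\<close>

definition mStirling2 :: "nat \<Rightarrow> nat \<Rightarrow> nat \<Rightarrow> real" where
  "mStirling2 n k m =
     1 / fact k * (\<Sum>j=0..k. (-1) ^ (k - j) * real (k choose j) * real j ^ n * pochhammer (real j) m)"

text \<open>Finite simple graphs are those of the locale \<open>pair_graph\<close>: every edge \<open>{u, v}\<close> is present in
  \<open>parcs\<close> as both \<open>(u, v)\<close> and \<open>(v, u)\<close>. An orientation keeps exactly one of the two.\<close>

definition is_orientation :: "'a pair_pre_digraph \<Rightarrow> 'a rel \<Rightarrow> bool" where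
  "is_orientation G D \<longleftrightarrow>
     D \<subseteq> parcs G \<and> (\<forall>(u, v) \<in> parcs G. ((u, v) \<in> D) \<noteq> ((v, u) \<in> D))"

definition compatible_orientation :: "('a \<Rightarrow> nat) \<Rightarrow> 'a rel \<Rightarrow> bool" where
  "compatible_orientation \<sigma> D \<longleftrightarrow> acyclic D \<and> (\<forall>(u, v) \<in> D. \<sigma> u \<ge> \<sigma> v)"

text \<open>Maps on the vertex set are taken extensional (\<open>\<rightarrow>\<^sub>E\<close>), so that each one is counted once.\<close>

definition Pbar :: "'a pair_pre_digraph \<Rightarrow> nat \<Rightarrow> nat" where
  "Pbar G x = card {(\<sigma>, D). \<sigma> \<in> pverts G \<rightarrow>\<^sub>E {1..x} \<and> is_orientation G D
                          \<and> compatible_orientation \<sigma> D}"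

definition empty_graph :: "nat \<Rightarrow> nat pair_pre_digraph" where
  "empty_graph n = \<lparr>pverts = {..<n}, parcs = {}\<rparr>"

definition complete_graph :: "nat \<Rightarrow> nat pair_pre_digraph" where
  "complete_graph m = \<lparr>pverts = {..<m}, parcs = {(u, v). u < m \<and> v < m \<and> u \<noteq> v}\<rparr>"

definition disjoint_union ::
    "'a pair_pre_digraph \<Rightarrow> 'b pair_pre_digraph \<Rightarrow> ('a + 'b) pair_pre_digraph" where
  "disjoint_union G H =
     \<lparr>pverts = pverts G <+> pverts H,
      parcs = map_prod Inl Inl ` parcs G \<union> map_prod Inr Inr ` parcs H\<rparr>"

lemma pair_graph_empty_graph: "pair_graph (empty_graph n)"
  by unfold_locales (auto simp: empty_graph_def symmetric_def sym_def)

lemma finite_parcs_complete_graph: "finite (parcs (complete_graph m))"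
  by (rule finite_subset[of _ "{..<m} \<times> {..<m}"]) (auto simp: complete_graph_def)

lemma pair_graph_complete_graph: "pair_graph (complete_graph m)"
  using finite_parcs_complete_graph[of m]
  by unfold_locales (auto simp: complete_graph_def symmetric_def sym_def)

lemma complete_digraph_complete_graph: "complete_digraph m (with_proj (complete_graph m))"
  using pair_graph.pair_graphD_graph[OF pair_graph_complete_graph]
  by (auto simp: complete_digraph_def complete_graph_def)

lemma pair_graph_disjoint_union:
  assumes "pair_graph G" "pair_graph H"
  shows "pair_graph (disjoint_union G H)"
proof -
  interpret G: pair_graph G by fact
  interpret H: pair_graph H by fact
  show ?thesis
  proof unfold_locales
    show "symmetric (with_proj (disjoint_union G H))"
      using G.arcs_symmetric H.arcs_symmetric
      unfolding symmetric_def by (force simp: disjoint_union_def intro!: symI)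
  qed (use G.no_loops' H.no_loops' in
      \<open>auto simp: disjoint_union_def intro: G.in_arcsD1 G.in_arcsD2 H.in_arcsD1 H.in_arcsD2\<close>)
qed

lemma (in pair_graph) finite_Pbar_pairs:
  "finite {(\<sigma>, D). \<sigma> \<in> pverts G \<rightarrow>\<^sub>E {1..x} \<and> is_orientation G D \<and> compatible_orientation \<sigma> D}"
  by (rule finite_subset[of _ "(pverts G \<rightarrow>\<^sub>E {1..x}) \<times> Pow (parcs G)"])
    (auto simp: is_orientation_def finite_PiE pair_finite_verts pair_finite_arcs)

end

theory Submission
  imports Defs
begin

text \<open>A compatible pair \<open>(\<sigma>, D)\<close> on a clique is encoded by adding to each colour \<open>\<sigma> v\<close> the out-degree
  of \<open>v\<close> in \<open>D\<close>. Since an acyclic orientation of a clique is a strict linear order, this is strictly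
  decreasing along \<open>D\<close>, so the result is an injection of the \<open>m\<close> vertices into \<open>{1..<x + m}\<close> from which
  \<open>D\<close>, and then \<open>\<sigma>\<close>, can be read off. There are \<open>x (x + 1) \<cdots> (x + m - 1)\<close> such injections, and
  isolated vertices are coloured freely.\<close>

text \<open>The target interval has \<open>x + card W - 1\<close> elements, so the count is a
  falling factorial whose last factor is \<open>x\<close>; read backwards it is the rising
  factorial. For \<open>x = 0\<close> and nonempty \<open>W\<close> both sides vanish.\<close>

lemma card_inj_funcset_pochhammer:
  assumes "finite W"
  shows "card {f \<in> W \<rightarrow>\<^sub>E {1..<x + card W}. inj_on f W} = pochhammer x (card W)"
proof -
  let ?m = "card W"
  have "card {f \<in> W \<rightarrow>\<^sub>E {1..<x + ?m}. inj_on f W} = (\<Prod>i<?m. (x + ?m - 1) - i)"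
    using card_inj_on_subset_funcset[OF assms, of "{1..<x + ?m}" W]
    by (simp add: lessThan_atLeast0)
  also have "\<dots> = (\<Prod>i<?m. x + (?m - Suc i))"
    by (intro prod.cong) auto
  also have "\<dots> = pochhammer x ?m"
    using prod.nat_diff_reindex[of "\<lambda>i. x + i" ?m]
    by (simp add: pochhammer_prod lessThan_atLeast0)
  finally show ?thesis .
qed

lemma card_between_inj_on_le:
  fixes f :: "'a \<Rightarrow> nat"
  assumes "inj_on f W"
  shows "card {w \<in> W. a \<le> f w \<and> f w < b} \<le> b - a"
proof -
  have "card {w \<in> W. a \<le> f w \<and> f w < b} \<le> card {a..<b}"
    using assms by (intro card_inj_on_le[of f]) (auto intro: inj_on_subset)
  then show ?thesis by simp
qed

text \<open>These bounds make \<open>f v - r v\<close> a colour in \<open>{1..x}\<close> that is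
  monotone in \<open>f v\<close>. Injectivity allows at most as many vertices as integers in an
  interval of values; this is applied to \<open>{1..<f v}\<close>, \<open>{f v..<x + card W}\<close>
  and \<open>{f u..<f v}\<close> in turn. The third bound is additive to avoid truncated
  subtraction.\<close>

lemma inj_rank_bounds:
  fixes f :: "'a \<Rightarrow> nat"
  assumes "finite W" "inj_on f W" "f ` W \<subseteq> {1..<x + card W}" "v \<in> W"
  defines "r \<equiv> \<lambda>v. card {w \<in> W. f w < f v}"
  shows "r v < f v" "f v \<le> x + r v" "f u \<le> f v \<Longrightarrow> f u + r v \<le> f v + r u"
proof -
  have fv: "1 \<le> f v" "f v < x + card W" using assms by auto
  have "{w \<in> W. f w < f v} = {w \<in> W. 1 \<le> f w \<and> f w < f v}" using assms(3) by auto
  then have "r v \<le> f v - 1"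
    using card_between_inj_on_le[OF assms(2), of 1 "f v"] by (simp add: r_def)
  then show "r v < f v" using fv by simp
  have "W = {w \<in> W. f w < f v} \<union> {w \<in> W. f v \<le> f w \<and> f w < x + card W}"
    using assms(3) by fastforce
  then have "card W \<le> r v + card {w \<in> W. f v \<le> f w \<and> f w < x + card W}"
    unfolding r_def by (metis (no_types, lifting) card_Un_le)
  then show "f v \<le> x + r v"
    using card_between_inj_on_le[OF assms(2), of "f v" "x + card W"] fv by simp
  assume "f u \<le> f v"
  then have "{w \<in> W. f w < f v} = {w \<in> W. f w < f u} \<union> {w \<in> W. f u \<le> f w \<and> f w < f v}"
    by auto
  then have "r v \<le> r u + card {w \<in> W. f u \<le> f w \<and> f w < f v}"
    unfolding r_def by (metis (no_types, lifting) card_Un_le)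
  then show "f u + r v \<le> f v + r u"
    using card_between_inj_on_le[OF assms(2), of "f u" "f v"] \<open>f u \<le> f v\<close> by simp
qed

text \<open>Given arcs from \<open>u\<close> to \<open>v\<close> and from \<open>v\<close> to
  \<open>w\<close>, acyclicity excludes both \<open>u = w\<close> and an arc back from
  \<open>w\<close> to \<open>u\<close>. The clique edge between \<open>u\<close> and
  \<open>w\<close> must then point forward.\<close>

lemma clique_acyclic_orientation_trans:
  assumes "parcs G = {(u, v). u \<in> W \<and> v \<in> W \<and> u \<noteq> v}" "is_orientation G D" "acyclic D"
  shows "trans D"
proof (rule transI)
  fix u v w assume uv: "(u, v) \<in> D" and vw: "(v, w) \<in> D"
  have "(u, w) \<in> D\<^sup>+" using uv vw by (meson trancl.intros)
  then have "u \<noteq> w" "(w, u) \<notin> D"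
    using assms(3) trancl_into_trancl unfolding acyclic_def by metis+
  moreover have "u \<in> W" "w \<in> W" using uv vw assms(1,2) unfolding is_orientation_def by blast+
  ultimately show "(u, w) \<in> D" using assms(1,2) unfolding is_orientation_def by blast
qed

lemma Pbar_clique_with_isolated_vertices:
  assumes fin: "finite (pverts G)" and W: "W \<subseteq> pverts G"
    and arcs: "parcs G = {(u, v). u \<in> W \<and> v \<in> W \<and> u \<noteq> v}"
  shows "Pbar G x = x ^ card (pverts G - W) * pochhammer x (card W)"
proof -
  let ?V = "pverts G"
  let ?A = "{(\<sigma>, D). \<sigma> \<in> ?V \<rightarrow>\<^sub>E {1..x} \<and> is_orientation G D \<and> compatible_orientation \<sigma> D}"
  let ?F = "{f \<in> W \<rightarrow>\<^sub>E {1..<x + card W}. inj_on f W}"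
  let ?B = "((?V - W) \<rightarrow>\<^sub>E {1..x}) \<times> ?F"
  define encode where
    "encode = (\<lambda>(\<sigma>, D :: 'a rel). (restrict \<sigma> (?V - W), \<lambda>v\<in>W. \<sigma> v + card (D `` {v})))"
  \<comment> \<open>Arcs are recovered by pointing from larger to smaller values of
    \<open>f\<close>. The out-degree of \<open>v\<close> then equals its \<open>rank\<close>, and
    subtracting it leaves the colour.\<close>
  define rank where "rank = (\<lambda>(f :: 'a \<Rightarrow> nat) v. card {w \<in> W. f w < f v})"
  define ord where "ord = (\<lambda>f :: 'a \<Rightarrow> nat. {(u, v). u \<in> W \<and> v \<in> W \<and> f v < f u})"
  define decode where
    "decode = (\<lambda>(g, f). (\<lambda>v\<in>?V. if v \<in> W then f v - rank f v else g v, ord f))"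
  have finW: "finite W" using fin W by (rule finite_subset[rotated])

  have encode: "encode (\<sigma>, D) \<in> ?B \<and> decode (encode (\<sigma>, D)) = (\<sigma>, D)"
    if "(\<sigma>, D) \<in> ?A" for \<sigma> D
  proof -
    from that have \<sigma>: "\<sigma> \<in> ?V \<rightarrow>\<^sub>E {1..x}" and D: "is_orientation G D" and ac: "acyclic D"
      and mono: "\<And>u v. (u, v) \<in> D \<Longrightarrow> \<sigma> v \<le> \<sigma> u"
      by (auto simp: compatible_orientation_def)
    define f where "f = (\<lambda>v\<in>W. \<sigma> v + card (D `` {v}))"
    have fv: "f v = \<sigma> v + card (D `` {v})" if "v \<in> W" for v using that by (simp add: f_def)
    have DW: "D \<subseteq> W \<times> W" using D arcs by (auto simp: is_orientation_def)
    have tot: "(u, v) \<in> D \<or> (v, u) \<in> D" if "u \<in> W" "v \<in> W" "u \<noteq> v" for u v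
      using D arcs that unfolding is_orientation_def by blast
    have irr: "(u, u) \<notin> D" for u using ac by (auto simp: acyclic_def)
    have "trans D" using clique_acyclic_orientation_trans[OF arcs D ac] .
    have decr: "f v < f u" if uv: "(u, v) \<in> D" for u v
    proof -
      \<comment> \<open>Transitivity gives the inclusion; it is strict because \<open>v\<close> is
        an out-neighbour of \<open>u\<close> but not of itself.\<close>
      have "D `` {v} \<subset> D `` {u}" using uv irr \<open>trans D\<close> by (auto dest: transD)
      moreover have "finite (D `` {u})" using DW finW by (auto intro: finite_subset)
      ultimately have "card (D `` {v}) < card (D `` {u})" by (rule psubset_card_mono[rotated])
      then show ?thesis using mono[OF uv] uv DW by (auto simp: f_def)
    qed
    have inj: "inj_on f W" using tot decr by (metis inj_onI less_irrefl)
    \<comment> \<open>If \<open>f v < f u\<close>, totality leaves only the arc from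
      \<open>u\<close> to \<open>v\<close>, since the reverse arc would contradict
      \<open>decr\<close>.\<close>
    have "(u, v) \<in> ord f \<longleftrightarrow> (u, v) \<in> D" for u v
      using DW decr[of u v] decr[of v u] tot[of u v] by (cases "u = v") (auto simp: ord_def)
    then have ord: "ord f = D" by auto
    have rank: "rank f v = card (D `` {v})" if "v \<in> W" for v
    proof -
      have "{w \<in> W. f w < f v} = D `` {v}" using that unfolding ord[symmetric]
        by (auto simp: ord_def)
      then show ?thesis by (simp add: rank_def)
    qed
    have f: "f v \<in> {1..<x + card W}" if "v \<in> W" for v
    proof -
      \<comment> \<open>No vertex is its own out-neighbour, so out-degrees stay below
        \<open>card W\<close>; hence the strict upper end \<open>x + card W\<close>.\<close>
      have "D `` {v} \<subset> W" using DW irr that by auto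
      then have "card (D `` {v}) < card W" by (rule psubset_card_mono[OF finW])
      moreover have "\<sigma> v \<in> {1..x}" using \<sigma> W that by auto
      ultimately show ?thesis using that by (auto simp: f_def)
    qed
    have "f \<in> extensional W" by (simp add: f_def)
    then have "f \<in> ?F" using f inj by (simp add: PiE_iff)
    moreover have "(\<lambda>v\<in>?V. if v \<in> W then f v - rank f v else restrict \<sigma> (?V - W) v) = \<sigma>"
      by (rule extensionalityI[of _ ?V]) (use \<sigma> in \<open>auto simp: rank fv PiE_iff\<close>)
    then have "decode (restrict \<sigma> (?V - W), f) = (\<sigma>, D)"
      by (simp add: decode_def ord)
    moreover have "encode (\<sigma>, D) = (restrict \<sigma> (?V - W), f)" by (simp add: encode_def f_def)
    moreover have "restrict \<sigma> (?V - W) \<in> (?V - W) \<rightarrow>\<^sub>E {1..x}" using \<sigma> by auto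
    ultimately show ?thesis by simp
  qed

  have decode: "decode (g, f) \<in> ?A \<and> encode (decode (g, f)) = (g, f)" if "(g, f) \<in> ?B" for g f
  proof -
    from that have g: "g \<in> (?V - W) \<rightarrow>\<^sub>E {1..x}" and f: "f \<in> W \<rightarrow>\<^sub>E {1..<x + card W}"
      and inj: "inj_on f W" by auto
    define \<sigma> where "\<sigma> = (\<lambda>v\<in>?V. if v \<in> W then f v - rank f v else g v)"
    have img: "f ` W \<subseteq> {1..<x + card W}" using f by auto
    have b1: "rank f v < f v" "f v \<le> x + rank f v" if "v \<in> W" for v
      using inj_rank_bounds(1,2)[OF finW inj img that] by (auto simp: rank_def)
    have b3: "f u + rank f v \<le> f v + rank f u" if "v \<in> W" "f u \<le> f v" for u v
      using inj_rank_bounds(3)[OF finW inj img that] by (auto simp: rank_def)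
    have "\<sigma> v \<in> {1..x}" if "v \<in> ?V" for v
    proof (cases "v \<in> W")
      case True
      then show ?thesis using that b1[of v] by (auto simp: \<sigma>_def)
    next
      case False
      then have "g v \<in> {1..x}" using that g by (simp add: PiE_iff)
      then show ?thesis using that False by (simp add: \<sigma>_def)
    qed
    moreover have "\<sigma> \<in> extensional ?V" by (simp add: \<sigma>_def)
    ultimately have \<sigma>: "\<sigma> \<in> ?V \<rightarrow>\<^sub>E {1..x}" by (simp add: PiE_iff)
    \<comment> \<open>Distinct vertices of \<open>W\<close> have distinct values, so exactly one
      direction of each edge is chosen.\<close>
    have "is_orientation G (ord f)"
      using inj by (auto simp: is_orientation_def arcs ord_def inj_on_def) (metis nat_neq_iff)
    moreover have "acyclic (ord f)" by (rule acyclicI_order[of _ f]) (auto simp: ord_def)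
    \<comment> \<open>\<open>b3\<close> compares the two differences in additive form, and
      \<open>b1\<close> ensures that the subtractions defining \<open>\<sigma>\<close> are not
      truncated.\<close>
    moreover have "\<sigma> v \<le> \<sigma> u" if "(u, v) \<in> ord f" for u v
      using that W b3[of u v] b1[of u] b1[of v] by (auto simp: ord_def \<sigma>_def)
    ultimately have "(\<sigma>, ord f) \<in> ?A" using \<sigma> by (auto simp: compatible_orientation_def)
    moreover have "encode (\<sigma>, ord f) = (g, f)"
    proof -
      have "restrict \<sigma> (?V - W) = g"
        by (rule extensionalityI[of _ "?V - W"]) (use g in \<open>auto simp: \<sigma>_def PiE_iff\<close>)
      moreover have "card (ord f `` {v}) = rank f v" if "v \<in> W" for v
        using that by (simp add: ord_def rank_def Image_def)
      \<comment> \<open>Adding back the rank restores \<open>f v\<close> because \<open>b1\<close>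
        gives \<open>rank f v < f v\<close>.\<close>
      then have "\<sigma> v + card (ord f `` {v}) = f v" if "v \<in> W" for v
        using that W b1(1)[OF that] by (auto simp: \<sigma>_def)
      then have "(\<lambda>v\<in>W. \<sigma> v + card (ord f `` {v})) = f"
        by (intro extensionalityI[of _ W]) (use f in \<open>simp_all add: PiE_iff\<close>)
      ultimately show ?thesis by (simp add: encode_def)
    qed
    moreover have "decode (g, f) = (\<sigma>, ord f)" by (simp add: decode_def \<sigma>_def)
    ultimately show ?thesis by simp
  qed

  have "bij_betw encode ?A ?B"
    by (rule bij_betw_byWitness[where f' = decode];
        simp only: split_paired_All image_subset_iff Ball_def; intro allI impI;
        rule encode[THEN conjunct1] encode[THEN conjunct2]
          decode[THEN conjunct1] decode[THEN conjunct2]; assumption)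
  then have "Pbar G x = card ?B" unfolding Pbar_def by (rule bij_betw_same_card)
  also have "\<dots> = x ^ card (?V - W) * pochhammer x (card W)"
    using card_inj_funcset_pochhammer[OF finW, of x] fin
    by (simp add: card_cartesian_product card_PiE)
  finally show ?thesis .
qed

lemma Pbar_empty_union_complete:
  "Pbar (disjoint_union (empty_graph n) (complete_graph m)) x = x ^ n * pochhammer x m"
proof -
  let ?G = "disjoint_union (empty_graph n) (complete_graph m)"
  have V: "pverts ?G = {..<n} <+> {..<m}"
    by (simp add: disjoint_union_def empty_graph_def complete_graph_def)
  have "parcs ?G = {(u, v). u \<in> Inr ` {..<m} \<and> v \<in> Inr ` {..<m} \<and> u \<noteq> v}"
    by (force simp: disjoint_union_def empty_graph_def complete_graph_def)
  moreover have "pverts ?G - Inr ` {..<m} = Inl ` {..<n}" unfolding V by auto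
  ultimately show ?thesis
    using Pbar_clique_with_isolated_vertices[of ?G "Inr ` {..<m}" x]
    by (auto simp: V card_image)
qed

theorem theorem3p8:
  fixes n m k :: nat
  shows "mStirling2 n k m =
    1 / fact k * (\<Sum>j=0..k. (-1) ^ (k - j) * real (k choose j)
                    * real (Pbar (disjoint_union (empty_graph n) (complete_graph m)) j))"
  \<comment> \<open>The sums agree term by term; \<open>pochhammer_of_nat\<close> carries the
    natural-number Pochhammer symbol over to the reals.\<close>
  by (simp add: mStirling2_def Pbar_empty_union_complete pochhammer_of_nat mult.assoc)

end
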